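(* If $X$ is any strongly anti-Urysohn space, then $\mathfrak s\le |X|\le 2^{2^{\mathfrak c}}$.
   Context: "Space" means infinite Hausdorff topological space. A space $X$ is strongly anti-Urysohn (SAU) if it has at least two non-isolated points and any two infinite closed subsets of $X$ intersect. A set $A$ splits a set $B$ if both $B\cap A$ and $B\setminus A$ are infinite; $\mathfrak s$ (the splitting number) is the smallest cardinality of a family $\mathcal A$ of sets such that every infinite subset of $\omega$ is split by some member of $\mathcal A$. $\mathfrak c=2^\omega$. *)

theory Defs
  imports "HOL-Analysis.T1_Spaces" "HOL-Library.Countable_Set"
begin

unbundle cardinal_syntax

text \<open>Cardinals are represented by cardinal orders, compared by \<^term>\<open>(\<le>o)\<close>; \<^term>\<open>natLeq\<close> is
  the cardinal \<open>\<omega>\<close>.\<close>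

definition strongly_anti_Urysohn :: "'a topology \<Rightarrow> bool" where
  "strongly_anti_Urysohn X \<longleftrightarrow>
     infinite (topspace X) \<and> Hausdorff_space X \<and>
     (\<exists>x \<in> topspace X. \<exists>y \<in> topspace X. x \<noteq> y \<and> \<not> openin X {x} \<and> \<not> openin X {y}) \<and>
     (\<forall>F G. closedin X F \<and> infinite F \<and> closedin X G \<and> infinite G \<longrightarrow> F \<inter> G \<noteq> {})"

definition splits :: "'a set \<Rightarrow> 'a set \<Rightarrow> bool" where
  "splits A B \<longleftrightarrow> infinite (B \<inter> A) \<and> infinite (B - A)"

definition splitting_family :: "nat set set \<Rightarrow> bool" where
  "splitting_family \<A> \<longleftrightarrow> (\<forall>B. infinite B \<longrightarrow> (\<exists>A \<in> \<A>. splits A B))"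

text \<open>A least element, unique up to \<^term>\<open>(=o)\<close>, of the class of cardinals of splitting
  families. It exists by \<open>splitting_number_attained\<close> and \<open>splitting_number_least\<close> below.\<close>

definition splitting_number :: "nat set rel" where
  "splitting_number =
     (SOME r. (\<exists>\<A>. splitting_family \<A> \<and> r = |\<A>| ) \<and>
              (\<forall>\<A>. splitting_family \<A> \<longrightarrow> r \<le>o |\<A>| ))"

definition continuum :: "(nat \<Rightarrow> bool) rel" where
  "continuum = ctwo ^c natLeq"

lemma splitting_family_UNIV: "splitting_family UNIV"
  unfolding splitting_family_def
proof (intro allI impI)
  fix B :: "nat set"
  assume "infinite B"
  then have "bij_betw (from_nat_into B) UNIV B"
    by (intro bij_betw_from_nat_into) auto
  then have inj: "inj (from_nat_into B)" and im: "range (from_nat_into B) = B"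
    by (auto simp: bij_betw_def)
  define A where "A = from_nat_into B ` {n. even n}"
  have "infinite {n::nat. even n}" "infinite {n::nat. odd n}"
    unfolding infinite_nat_iff_unbounded_le by (simp_all, presburger+)
  moreover have "B \<inter> A = from_nat_into B ` {n. even n}"
    using im by (auto simp: A_def)
  moreover have "B - A = from_nat_into B ` {n. odd n}"
    using im inj by (auto simp: A_def inj_eq)
  ultimately have "splits A B"
    using inj by (simp add: splits_def finite_image_iff inj_on_subset[OF inj])
  then show "\<exists>A\<in>UNIV. splits A B"
    by blast
qed

lemma splitting_number_exists:
  "(\<exists>\<A>. splitting_family \<A> \<and> splitting_number = |\<A>| ) \<and>
   (\<forall>\<A>. splitting_family \<A> \<longrightarrow> splitting_number \<le>o |\<A>| )"
proof -
  let ?R = "card_of ` {\<A>. splitting_family \<A>}"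
  have "?R \<noteq> {}" "\<forall>r\<in>?R. Card_order r"
    using splitting_family_UNIV by (auto simp only: card_of_Card_order)
  from exists_minim_Card_order[OF this] obtain \<A> where
    "splitting_family \<A>" and "\<forall>\<B>. splitting_family \<B> \<longrightarrow> |\<A>| \<le>o |\<B>|"
    by blast
  then have "\<exists>r. (\<exists>\<A>. splitting_family \<A> \<and> r = |\<A>| ) \<and> (\<forall>\<A>. splitting_family \<A> \<longrightarrow> r \<le>o |\<A>| )"
    by blast
  then show ?thesis
    unfolding splitting_number_def by (rule someI_ex)
qed

lemma splitting_number_attained: "\<exists>\<A>. splitting_family \<A> \<and> splitting_number = |\<A>|"
  using splitting_number_exists by blast

lemma splitting_number_least: "splitting_family \<A> \<Longrightarrow> splitting_number \<le>o |\<A>|"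
  using splitting_number_exists by blast

end

(* Separate the points of a set S by open sets U x y containing x whose closure misses y. If
   no U x y splits an infinite set B, then B has at most one accumulation point in S. In a
   strongly anti-Urysohn space X it is impossible that every countable infinite set has an
   infinite subset with at most one accumulation point: all these points would coincide, which
   contradicts the existence of two non-isolated points.

   Lower bound: if |X| were smaller than the splitting number, then on every countable set some
   infinite B would not be split by the |X| many sets U x y.
   Upper bound: take S to be the closure of a countable infinite set A all of whose infinite
   subsets have two accumulation points; then |S| \<le> 2^c. If |X| were larger than 2^(2^c), then infinitely many
   points outside S would lie in the same sets U x y, and the closure of the set of these points
   would meet S in at most one point, so it would miss an infinite closed subset of S. *)
theory Submission
  imports Defs "HOL-Library.Countable_Set_Type"
begin

section \<open>Cardinal bounds and separation in Hausdorff spaces\<close>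

lemma card_of_Pow_ordLeq_cexp:
  assumes "|A| \<le>o r" "A \<noteq> {}"
  shows "|Pow A| \<le>o ctwo ^c r"
proof -
  have "|Pow A| =o ctwo ^c |A|"
    unfolding ctwo_def cexp_def Field_card_of by (rule card_of_Pow_Func)
  also have "ctwo ^c |A| \<le>o ctwo ^c r"
    using assms by (intro cexp_mono2' Card_order_ctwo) (auto simp: Field_card_of)
  finally show ?thesis .
qed

lemma Hausdorff_space_infinite_derived_set_of:
  assumes "Hausdorff_space X"
  shows "x \<in> X derived_set_of S \<longleftrightarrow>
    x \<in> topspace X \<and> (\<forall>U. x \<in> U \<and> openin X U \<longrightarrow> infinite (S \<inter> U))"
  using Hausdorff_imp_t1_space[OF assms] unfolding t1_space_derived_set_of_infinite_openin
  by simp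

text \<open>Removing from a finite neighbourhood its other points, a closed set, would leave
  \<open>{x}\<close> open.\<close>

lemma infinite_nonisolated_neighbourhood:
  assumes "Hausdorff_space X" "x \<in> topspace X" "\<not> openin X {x}" "openin X U" "x \<in> U"
  shows "infinite U"
proof
  assume "finite U"
  then have "closedin X (U - {x})"
    using assms openin_subset[OF assms(4)]
    by (intro closedin_Hausdorff_finite) auto
  then have "openin X (U - (U - {x}))"
    using assms(4) by blast
  moreover have "U - (U - {x}) = {x}"
    using assms(5) by blast
  ultimately show False
    using assms(3) by simp
qed

text \<open>Fixes one set per ordered pair of points, so that both bounds can count pairs of points
  instead of open sets. The witness \<open>V\<close> keeps \<open>y\<close> out of the closure of
  \<open>U x y\<close>.\<close>

lemma Hausdorff_space_separating_opens:
  assumes "Hausdorff_space X"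
  shows "\<exists>U. \<forall>x \<in> topspace X. \<forall>y \<in> topspace X. x \<noteq> y \<longrightarrow>
    openin X (U x y) \<and> x \<in> U x y \<and> (\<exists>V. openin X V \<and> y \<in> V \<and> disjnt (U x y) V)"
proof -
  have "\<exists>W. x \<in> topspace X \<longrightarrow> y \<in> topspace X \<longrightarrow> x \<noteq> y \<longrightarrow>
    openin X W \<and> x \<in> W \<and> (\<exists>V. openin X V \<and> y \<in> V \<and> disjnt W V)" for x y
    using assms unfolding Hausdorff_space_def by meson
  then show ?thesis
    by metis
qed

text \<open>Each of \<open>U\<close> and \<open>V\<close> contains infinitely many points of
  \<open>B\<close>, and those in \<open>V\<close> lie outside \<open>U\<close>. Read
  contrapositively, it bounds the accumulation points of an unsplit set.\<close>

lemma derived_set_of_unsplit: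
  assumes "Hausdorff_space X"
    and "p \<in> X derived_set_of B" "q \<in> X derived_set_of B"
    and "openin X U" "p \<in> U" "openin X V" "q \<in> V" "disjnt U V"
  shows "splits U B"
proof -
  have "infinite (B \<inter> U)" "infinite (B \<inter> V)"
    using assms by (auto simp: Hausdorff_space_infinite_derived_set_of)
  moreover have "B \<inter> V \<subseteq> B - U"
    using assms(8) by (auto simp: disjnt_iff)
  ultimately show ?thesis
    unfolding splits_def using finite_subset by blast
qed

text \<open>A point of the closure is determined by the traces on \<open>A\<close> of its open
  neighbourhoods.\<close>

lemma card_of_closure_of_Hausdorff:
  assumes "Hausdorff_space X"
  shows "|X closure_of A| \<le>o |Pow (Pow A)|"
proof -
  define f where "f x = {A \<inter> U | U. openin X U \<and> x \<in> U}" for x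
  have "inj_on f (X closure_of A)"
  proof (rule inj_onI, rule ccontr)
    fix x y
    assume x: "x \<in> X closure_of A" and y: "y \<in> X closure_of A" and eq: "f x = f y"
      and ne: "x \<noteq> y"
    obtain U V where UV: "openin X U" "openin X V" "x \<in> U" "y \<in> V" "disjnt U V"
      using assms x y ne unfolding Hausdorff_space_def in_closure_of by meson
    then have "A \<inter> U \<in> f y"
      using eq by (auto simp: f_def)
    then obtain W where W: "openin X W" "y \<in> W" "A \<inter> U = A \<inter> W"
      by (auto simp: f_def)
    \<comment> \<open>A point of \<open>A\<close> in this neighbourhood of \<open>y\<close> lies in
      \<open>A \<inter> W = A \<inter> U\<close>, although \<open>U\<close> and \<open>V\<close> are
      disjoint.\<close>
    have "openin X (V \<inter> W)" "y \<in> V \<inter> W"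
      using UV W by auto
    then obtain a where "a \<in> A" "a \<in> V" "a \<in> W"
      using y unfolding in_closure_of by blast
    then show False
      using W(3) UV(5) by (auto simp: disjnt_iff)
  qed
  then show ?thesis
    by (rule card_of_ordLeqI) (auto simp: f_def)
qed

section \<open>Accumulation points in strongly anti-Urysohn spaces\<close>

lemma strongly_anti_Urysohn_closure_inter:
  assumes "strongly_anti_Urysohn X"
    and "infinite A" "A \<subseteq> topspace X" "infinite B" "B \<subseteq> topspace X"
  shows "X closure_of A \<inter> X closure_of B \<noteq> {}"
proof -
  have "infinite (X closure_of A)" "infinite (X closure_of B)"
    using assms(2-) closure_of_subset finite_subset by metis+
  then show ?thesis
    using assms(1) unfolding strongly_anti_Urysohn_def by simp
qed

text \<open>Otherwise every subset of \<open>B\<close> is closed, and two disjoint infinite ones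
  contradict the hypothesis on \<open>X\<close>.\<close>

lemma strongly_anti_Urysohn_derived_nonempty:
  assumes X: "strongly_anti_Urysohn X" and B: "infinite B" "B \<subseteq> topspace X"
  shows "X derived_set_of B \<noteq> {}"
proof
  assume empty: "X derived_set_of B = {}"
  obtain C D where CD: "C \<subseteq> B" "D \<subseteq> B" "infinite C" "infinite D" "C \<inter> D = {}"
    using infinite_split[OF B(1)] .
  then have "X derived_set_of C = {}" "X derived_set_of D = {}"
    using empty derived_set_of_mono by blast+
  then have "X closure_of C \<inter> X closure_of D = {}"
    using CD(5) by (auto simp: closure_of)
  then show False
    using strongly_anti_Urysohn_closure_inter[OF X] CD B(2) by (meson order_trans)
qed

lemma strongly_anti_Urysohn_two_accumulation_points:
  assumes X: "strongly_anti_Urysohn X"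
  shows "\<exists>A. countable A \<and> infinite A \<and> A \<subseteq> topspace X \<and>
    (\<forall>B. B \<subseteq> A \<and> infinite B \<longrightarrow>
      (\<exists>x y. x \<in> X derived_set_of B \<and> y \<in> X derived_set_of B \<and> x \<noteq> y))"
proof (rule ccontr)
  assume no: "\<not> ?thesis"
  have H: "Hausdorff_space X"
    using X by (simp add: strongly_anti_Urysohn_def)
  note derived = Hausdorff_space_infinite_derived_set_of[OF H]
  \<comment> \<open>The negated claim only gives at most one accumulation point; that there is one
    comes from the preceding lemma.\<close>
  have converging: "\<exists>B p. B \<subseteq> A \<and> infinite B \<and> X derived_set_of B = {p}"
    if A: "infinite A" "A \<subseteq> topspace X" for A
  proof -
    obtain A' where A': "A' \<subseteq> A" "countable A'" "infinite A'"
      using infinite_countable_subset'[OF A(1)] by blast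
    then have "A' \<subseteq> topspace X"
      using A(2) by blast
    then obtain B where B: "B \<subseteq> A'" "infinite B"
      "\<And>x y. \<lbrakk>x \<in> X derived_set_of B; y \<in> X derived_set_of B\<rbrakk> \<Longrightarrow> x = y"
      using no A' by metis
    then have "X derived_set_of B \<noteq> {}"
      using strongly_anti_Urysohn_derived_nonempty[OF X] \<open>A' \<subseteq> topspace X\<close> by blast
    then have "\<exists>p. X derived_set_of B = {p}"
      using B(3) by blast
    then show ?thesis
      using A'(1) B by blast
  qed
  \<comment> \<open>Cutting \<open>B\<close> and \<open>C\<close> down to disjoint neighbourhoods of
    \<open>p\<close> and \<open>q\<close> keeps them infinite. Their closures add at most
    \<open>p\<close> and \<open>q\<close>, hence stay disjoint.\<close>
  have unique: "p = q"
    if p: "B \<subseteq> topspace X" "X derived_set_of B = {p}"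
      and q: "C \<subseteq> topspace X" "X derived_set_of C = {q}" for B C p q
  proof (rule ccontr)
    assume "p \<noteq> q"
    have "p \<in> topspace X" "q \<in> topspace X"
      using derived_set_of_subset_topspace[of X B] derived_set_of_subset_topspace[of X C] p q
      by auto
    then obtain U V where UV: "openin X U" "openin X V" "p \<in> U" "q \<in> V" "disjnt U V"
      using H \<open>p \<noteq> q\<close> unfolding Hausdorff_space_def by meson
    have "infinite (B \<inter> U)" "infinite (C \<inter> V)"
      using derived[of p B] derived[of q C] p q UV by auto
    then have "X closure_of (B \<inter> U) \<inter> X closure_of (C \<inter> V) \<noteq> {}"
      using p q by (intro strongly_anti_Urysohn_closure_inter[OF X]) auto
    moreover have "X closure_of (B \<inter> U) \<subseteq> U" "X closure_of (C \<inter> V) \<subseteq> V"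
      using derived_set_of_mono[of "B \<inter> U" B X] derived_set_of_mono[of "C \<inter> V" C X] p q UV
      by (auto simp: closure_of)
    ultimately show False
      using UV(5) by (auto simp: disjnt_iff)
  qed
  have "infinite (topspace X)"
    using X by (simp add: strongly_anti_Urysohn_def)
  then obtain B p where B: "B \<subseteq> topspace X" "X derived_set_of B = {p}"
    using converging[of "topspace X"] by blast
  \<comment> \<open>Of two non-isolated points, at least one differs from the common accumulation
    point \<open>p\<close>. Near it, \<open>V\<close> is infinite and contains a set
    \<open>C\<close> that must accumulate at \<open>p\<close>, far from \<open>V\<close>.\<close>
  obtain q where q: "q \<in> topspace X" "q \<noteq> p" "\<not> openin X {q}"
    using X unfolding strongly_anti_Urysohn_def by metis
  have "p \<in> topspace X"
    using derived_set_of_subset_topspace[of X B] B by auto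
  then obtain U V where UV: "openin X U" "openin X V" "p \<in> U" "q \<in> V" "disjnt U V"
    using H q unfolding Hausdorff_space_def by metis
  have "infinite V"
    using infinite_nonisolated_neighbourhood[OF H] q UV by blast
  then obtain C p' where C: "C \<subseteq> V" "X derived_set_of C = {p'}"
    using converging[of V] openin_subset[OF UV(2)] by blast
  have "p' = p"
    using unique B C openin_subset[OF UV(2)] by (meson order_trans)
  then have "infinite (C \<inter> U)"
    using derived[of p C] C UV by auto
  moreover have "C \<inter> U = {}"
    using C(1) UV(5) by (auto simp: disjnt_iff)
  ultimately show False
    by simp
qed

section \<open>The lower bound\<close>

lemma splitting_number_le_strongly_anti_Urysohn:
  assumes X: "strongly_anti_Urysohn X"
  shows "splitting_number \<le>o |topspace X|"
proof -
  have H: "Hausdorff_space X" and inf: "infinite (topspace X)"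
    using X by (auto simp: strongly_anti_Urysohn_def)
  obtain U where U: "\<And>x y. \<lbrakk>x \<in> topspace X; y \<in> topspace X; x \<noteq> y\<rbrakk> \<Longrightarrow>
    openin X (U x y) \<and> x \<in> U x y \<and> (\<exists>V. openin X V \<and> y \<in> V \<and> disjnt (U x y) V)"
    using Hausdorff_space_separating_opens[OF H] by metis
  obtain A where A: "countable A" "infinite A" "A \<subseteq> topspace X"
    and two: "\<And>B. \<lbrakk>B \<subseteq> A; infinite B\<rbrakk> \<Longrightarrow>
      \<exists>x y. x \<in> X derived_set_of B \<and> y \<in> X derived_set_of B \<and> x \<noteq> y"
    using strongly_anti_Urysohn_two_accumulation_points[OF X] by metis
  define e where "e = from_nat_into A"
  have e: "inj e" "range e = A"
    using bij_betw_from_nat_into[OF A(1,2)] by (auto simp: e_def bij_betw_def)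
  \<comment> \<open>The sets \<open>U x y\<close> are pulled back along \<open>e\<close>, since
    splitting families live on the natural numbers.\<close>
  define \<A> where "\<A> = (\<lambda>(x, y). e -` U x y) ` (topspace X \<times> topspace X)"
  have "splitting_family \<A>"
    unfolding splitting_family_def
  proof (intro allI impI)
    fix N :: "nat set"
    assume "infinite N"
    then have "infinite (e ` N)"
      using e(1) by (meson finite_imageD inj_on_subset subset_UNIV)
    moreover have "e ` N \<subseteq> A"
      using e(2) by blast
    ultimately obtain x y where xy: "x \<in> X derived_set_of (e ` N)"
      "y \<in> X derived_set_of (e ` N)" "x \<noteq> y"
      using two by blast
    then have top: "x \<in> topspace X" "y \<in> topspace X"
      using derived_set_of_subset_topspace by fastforce+
    then have "splits (U x y) (e ` N)"
      using U[OF top xy(3)] derived_set_of_unsplit[OF H xy(1,2)] by blast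
    moreover have "e ` N \<inter> U x y = e ` (N \<inter> e -` U x y)"
      "e ` N - U x y = e ` (N - e -` U x y)"
      by auto
    ultimately have "splits (e -` U x y) N"
      unfolding splits_def by fastforce
    then show "\<exists>S\<in>\<A>. splits S N"
      using top by (auto simp: \<A>_def)
  qed
  then have "splitting_number \<le>o |\<A>|"
    by (rule splitting_number_least)
  also have "|\<A>| \<le>o |topspace X \<times> topspace X|"
    unfolding \<A>_def by (rule card_of_image)
  also have "|topspace X \<times> topspace X| =o |topspace X|"
    using inf by (rule card_of_Times_same_infinite)
  finally show ?thesis .
qed

section \<open>The upper bound\<close>

lemma strongly_anti_Urysohn_card_le:
  assumes X: "strongly_anti_Urysohn X"
  shows "|topspace X| \<le>o ctwo ^c (ctwo ^c continuum)"
proof -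
  have H: "Hausdorff_space X"
    using X by (simp add: strongly_anti_Urysohn_def)
  obtain U where U: "\<And>x y. \<lbrakk>x \<in> topspace X; y \<in> topspace X; x \<noteq> y\<rbrakk> \<Longrightarrow>
    openin X (U x y) \<and> x \<in> U x y \<and> (\<exists>V. openin X V \<and> y \<in> V \<and> disjnt (U x y) V)"
    using Hausdorff_space_separating_opens[OF H] by metis
  obtain A where A: "countable A" "infinite A" "A \<subseteq> topspace X"
    and two: "\<And>B. \<lbrakk>B \<subseteq> A; infinite B\<rbrakk> \<Longrightarrow>
      \<exists>x y. x \<in> X derived_set_of B \<and> y \<in> X derived_set_of B \<and> x \<noteq> y"
    using strongly_anti_Urysohn_two_accumulation_points[OF X] by metis
  define F where "F = X closure_of A"
  have F_top: "F \<subseteq> topspace X"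
    by (simp add: F_def closure_of_subset_topspace)
  have F_nonempty: "F \<noteq> {}"
    using A(2,3) closure_of_subset[of A X] by (auto simp: F_def)
  have der_F: "X derived_set_of A \<subseteq> F"
    by (simp add: F_def derived_set_of_subset_closure_of)

  have inf_c: "Cinfinite continuum"
    unfolding continuum_def using natLeq_Cinfinite
    by (rule Cinfinite_cexp[OF ordLeq_refl[OF Card_order_ctwo]])
  then have inf_2c: "Cinfinite (ctwo ^c continuum)"
    by (rule Cinfinite_cexp[OF ordLeq_refl[OF Card_order_ctwo]])
  then have inf_22c: "Cinfinite (ctwo ^c (ctwo ^c continuum))"
    by (rule Cinfinite_cexp[OF ordLeq_refl[OF Card_order_ctwo]])
  have "|A| \<le>o natLeq"
    using A(1) by (simp add: countable_card_le_natLeq)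
  then have "|Pow A| \<le>o continuum"
    unfolding continuum_def using A(2) by (intro card_of_Pow_ordLeq_cexp) auto
  then have "|Pow (Pow A)| \<le>o ctwo ^c continuum"
    by (rule card_of_Pow_ordLeq_cexp) auto
  then have card_F: "|F| \<le>o ctwo ^c continuum"
    unfolding F_def using card_of_closure_of_Hausdorff[OF H] ordLeq_transitive by blast
  then have "|F \<times> F| \<le>o ctwo ^c continuum"
    using inf_2c by (intro card_of_Times_ordLeq_infinite_Field) (auto simp: cinfinite_def)
  then have card_types: "|Pow (F \<times> F)| \<le>o ctwo ^c (ctwo ^c continuum)"
    using F_nonempty by (intro card_of_Pow_ordLeq_cexp) auto

  \<comment> \<open>The type of \<open>x\<close> records which separating sets for points of
    \<open>F\<close> contain it. There are at most 2^(2^c) types, so it suffices that each is taken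
    by finitely many points outside \<open>F\<close>.\<close>
  define T where "T x = {(p, q) \<in> F \<times> F. x \<in> U p q}" for x
  have fin: "finite {x \<in> topspace X - F. T x = t}" for t
  proof (rule ccontr)
    define B where "B = {x \<in> topspace X - F. T x = t}"
    assume "infinite {x \<in> topspace X - F. T x = t}"
    then have B: "infinite B" "B \<subseteq> topspace X" "B \<inter> F = {}"
      by (auto simp: B_def)
    \<comment> \<open>Points of equal type lie all inside or all outside
      \<open>U p q\<close>.\<close>
    have unsplit: "\<not> splits (U p q) B" if "p \<in> F" "q \<in> F" for p q
    proof -
      have "x \<in> U p q \<longleftrightarrow> (p, q) \<in> t" if "x \<in> B" for x
        using that \<open>p \<in> F\<close> \<open>q \<in> F\<close> by (auto simp: B_def T_def)
      then have "B \<inter> U p q = {} \<or> B - U p q = {}"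
        by blast
      then show ?thesis
        unfolding splits_def by (metis finite.emptyI)
    qed
    have one: "p = q" if "p \<in> X closure_of B \<inter> F" "q \<in> X closure_of B \<inter> F" for p q
    proof (rule ccontr)
      assume "p \<noteq> q"
      \<comment> \<open>As \<open>B\<close> misses \<open>F\<close>, points of its closure in
        \<open>F\<close> are accumulation points.\<close>
      have pq: "p \<in> X derived_set_of B" "q \<in> X derived_set_of B"
        using that B(3) by (auto simp: closure_of)
      have "p \<in> topspace X" "q \<in> topspace X"
        using that F_top by auto
      then have "splits (U p q) B"
        using U[of p q] \<open>p \<noteq> q\<close> derived_set_of_unsplit[OF H pq] by blast
      then show False
        using unsplit that by blast
    qed
    obtain p where p: "p \<in> X closure_of B" "p \<in> F"
      using strongly_anti_Urysohn_closure_inter[OF X B(1,2) A(2,3)] by (auto simp: F_def)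
    \<comment> \<open>A second accumulation point of \<open>A\<close> gives an infinite part
      \<open>A \<inter> W\<close> whose closure stays in \<open>F\<close> but avoids
      \<open>p\<close>, the only point of \<open>F\<close> in the closure of
      \<open>B\<close>.\<close>
    obtain p' where p': "p' \<in> X derived_set_of A" "p' \<noteq> p"
      using two[OF subset_refl A(2)] by metis
    have "p \<in> topspace X" "p' \<in> topspace X"
      using p p' F_top der_F by auto
    then obtain V W where VW: "openin X V" "openin X W" "p \<in> V" "p' \<in> W" "disjnt V W"
      using H p'(2) unfolding Hausdorff_space_def by metis
    have inf_W: "infinite (A \<inter> W)"
      using p'(1) VW by (auto simp: Hausdorff_space_infinite_derived_set_of[OF H])
    have "p \<notin> X closure_of (A \<inter> W)"
      using VW unfolding in_closure_of by (auto simp: disjnt_iff)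
    moreover have "X closure_of (A \<inter> W) \<subseteq> F"
      unfolding F_def by (simp add: closure_of_mono)
    ultimately have "X closure_of B \<inter> X closure_of (A \<inter> W) = {}"
      using one p by blast
    moreover have "A \<inter> W \<subseteq> topspace X"
      using A(3) by blast
    ultimately show False
      using strongly_anti_Urysohn_closure_inter[OF X B(1,2) inf_W] by blast
  qed

  have "topspace X - F \<subseteq> (\<Union>t \<in> Pow (F \<times> F). {x \<in> topspace X - F. T x = t})"
    by (auto simp: T_def)
  moreover have "|\<Union>t \<in> Pow (F \<times> F). {x \<in> topspace X - F. T x = t}| \<le>o ctwo ^c (ctwo ^c continuum)"
  proof (rule UNION_Cinfinite_bound[OF card_types _ inf_22c], rule ballI)
    fix t
    have "|{x \<in> topspace X - F. T x = t}| \<le>o natLeq"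
      using countable_finite[OF fin] by (simp only: countable_card_le_natLeq)
    also have "natLeq \<le>o ctwo ^c (ctwo ^c continuum)"
      using inf_22c by (rule natLeq_ordLeq_cinfinite)
    finally show "|{x \<in> topspace X - F. T x = t}| \<le>o ctwo ^c (ctwo ^c continuum)" .
  qed
  ultimately have "|topspace X - F| \<le>o ctwo ^c (ctwo ^c continuum)"
    using card_of_mono1 ordLeq_transitive by blast
  moreover have "|F| \<le>o ctwo ^c (ctwo ^c continuum)"
    using card_F inf_2c ordLeq_cexp2[OF ordLeq_refl[OF Card_order_ctwo]] ordLeq_transitive by blast
  ultimately have "|F \<union> (topspace X - F)| \<le>o ctwo ^c (ctwo ^c continuum)"
    using inf_22c by (intro Un_Cinfinite_bound)
  then show ?thesis
    using F_top by (simp add: Un_absorb1)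
qed

theorem theorem3p5:
  fixes X :: "'a topology"
  assumes "strongly_anti_Urysohn X"
  shows "splitting_number \<le>o |topspace X| \<and> |topspace X| \<le>o ctwo ^c (ctwo ^c continuum)"
  using splitting_number_le_strongly_anti_Urysohn strongly_anti_Urysohn_card_le assms by blast

end
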